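(* Let $n\ge1$, let $w=(w_1,\dots,w_n)\in\mathbb{N}^n$ with $w\ne 0$, and assume that $|w|=w_1+\cdots+w_n$ is even. For $J\subseteq[n]=\{1,\dots,n\}$ write $|w_J|=\sum_{j\in J}w_j$. Then for $\lambda=(|w|/2,|w|/2)$ and $\mu=w$ we have $$K(\lambda,\mu)=\pi\left(n,w,|w|/2\right)-\pi\left(n,w,|w|/2-1\right)=\sum_{\substack{J\subseteq[n]\\ |w_J|<|w|/2}}(-1)^{|J|}\binom{|w|/2-|w_J|+n-|J|-2}{n-2}.$$
   Context: $\mathbb{N}$ denotes the nonnegative integers. The Kostka number $K(\lambda,\mu)$ is the number of semistandard Young tableaux of shape $\lambda$ and content $\mu$ (rows weakly increasing, columns strictly increasing, the entry $i$ occurring $\mu_i$ times); here $\mu$ need not be weakly decreasing. For an integer $k$, $\pi(n,w,k)$ is the number of integer tuples $(\nu_1,\dots,\nu_n)$ with $0\le\nu_i\le w_i$ for all $i\in[n]$ and $\nu_1+\cdots+\nu_n=k$. Convention: $\binom{a}{b}=0$ unless $0\le b\le a$. *)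

theory Defs
  imports Main "HOL-Library.FuncSet"
begin

text \<open>
  A tuple \<open>(w_1, \<dots>, w_n)\<close> is represented by a length \<open>n\<close> together with a function on
  \<open>nat\<close> of which only the values on \<open>{1..n}\<close> are used. Sets of tuples or
  fillings that get counted consist of extensional functions, so that each object is counted once.
\<close>

text \<open>
  A partition is the list of its parts, in weakly decreasing order. Rows and columns of its
  diagram are numbered from 0, whereas tableau entries are positive integers.
\<close>

definition cells :: "nat list \<Rightarrow> (nat \<times> nat) set" where
  "cells lam = {(r, c). r < length lam \<and> c < lam ! r}"

definition ssyt :: "nat list \<Rightarrow> (nat \<times> nat \<Rightarrow> nat) \<Rightarrow> bool" where
  "ssyt lam T \<longleftrightarrow>
     T \<in> cells lam \<rightarrow>\<^sub>E {1..} \<and>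
     (\<forall>r c c'. (r, c) \<in> cells lam \<and> (r, c') \<in> cells lam \<and> c < c' \<longrightarrow> T (r, c) \<le> T (r, c')) \<and>
     (\<forall>r r' c. (r, c) \<in> cells lam \<and> (r', c) \<in> cells lam \<and> r < r' \<longrightarrow> T (r, c) < T (r', c))"

definition has_content :: "nat list \<Rightarrow> nat \<Rightarrow> (nat \<Rightarrow> nat) \<Rightarrow> (nat \<times> nat \<Rightarrow> nat) \<Rightarrow> bool" where
  "has_content lam n mu T \<longleftrightarrow>
     T ` cells lam \<subseteq> {1..n} \<and> (\<forall>i\<in>{1..n}. card {x \<in> cells lam. T x = i} = mu i)"

definition kostka :: "nat list \<Rightarrow> nat \<Rightarrow> (nat \<Rightarrow> nat) \<Rightarrow> nat" where
  "kostka lam n mu = card {T. ssyt lam T \<and> has_content lam n mu T}"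

text \<open>The number \<open>\<pi>(n, w, k)\<close>.\<close>

definition tuple_count :: "nat \<Rightarrow> (nat \<Rightarrow> nat) \<Rightarrow> int \<Rightarrow> nat" where
  "tuple_count n w k =
     card {\<nu> \<in> (\<Pi>\<^sub>E i\<in>{1..n}. {0..int (w i)}). (\<Sum>i\<in>{1..n}. \<nu> i) = k}"

text \<open>
  Integer arguments, because for \<open>n = 1\<close> the lower index \<open>n - 2\<close> is negative. Unlike
  \<open>gbinomial\<close>, this vanishes whenever the upper index is negative.
\<close>

definition binom :: "int \<Rightarrow> int \<Rightarrow> int" where
  "binom a b = (if 0 \<le> b \<and> b \<le> a then int (nat a choose nat b) else 0)"

end

theory Submission imports Defs begin

text \<open>
  A two-row tableau of content \<open>w\<close> is determined by the multiplicities \<open>\<nu>\<close> of the entries of its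
  second row, and column strictness becomes a ballot condition on \<open>\<nu>\<close>. Removing the largest letter
  gives a recursion for the number of ballot tuples of sum \<open>k\<close>. Since \<open>\<pi>(n, w, k)\<close> satisfies the same
  kind of recursion and is symmetric under \<open>k \<mapsto> |w| - k\<close>, a telescoping sum shows that this number is
  \<open>\<pi>(n, w, k) - \<pi>(n, w, k - 1)\<close> whenever \<open>2 k \<le> |w|\<close>.

  The generating function of \<open>\<pi>(n, w, k)\<close> is the product of the \<open>(1 - x ^ (w_i + 1)) / (1 - x)\<close>.
  Expanding the numerators gives the alternating sum over \<open>J\<close>, and taking the difference in \<open>k\<close>
  cancels one factor \<open>1 - x\<close>. Both sides are compared through difference equations in \<open>k\<close>, so no
  power series are needed.
\<close>

section \<open>Counting bounded tuples\<close>

text \<open>Splits by the value \<open>t\<close> at the new index. The recursions for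
  \<open>tuple_count\<close> and \<open>ballot_tuples\<close> both come from this.\<close>

lemma card_PiE_insert_filter:
  assumes "finite I" "a \<notin> I" "finite (A a)" "\<And>i. i \<in> I \<Longrightarrow> finite (A i)"
  shows "card {f \<in> Pi\<^sub>E (insert a I) A. Q f}
    = (\<Sum>t\<in>A a. card {f \<in> Pi\<^sub>E I A. Q (f(a := t))})"
proof -
  let ?S = "\<lambda>t. {f \<in> Pi\<^sub>E I A. Q (f(a := t))}"
  have fin: "finite (Pi\<^sub>E I A)"
    using assms by (intro finite_PiE) auto
  have inj: "inj_on (\<lambda>(t, f). f(a := t)) (SIGMA t:A a. ?S t)"
    by (rule inj_on_subset[OF inj_combinator[OF assms(2), of A]]) auto
  have "{f \<in> Pi\<^sub>E (insert a I) A. Q f} = (\<lambda>(t, f). f(a := t)) ` (SIGMA t:A a. ?S t)"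
    unfolding PiE_insert_eq by auto
  then have "card {f \<in> Pi\<^sub>E (insert a I) A. Q f} = card (SIGMA t:A a. ?S t)"
    using inj by (simp add: card_image)
  also have "\<dots> = (\<Sum>t\<in>A a. card (?S t))"
    using assms(3) fin by (intro card_SigmaI) auto
  finally show ?thesis .
qed

lemma sum_upd_Suc:
  fixes \<nu> :: "nat \<Rightarrow> int"
  shows "(\<Sum>i = 1..Suc n. (\<nu>(Suc n := t)) i) = (\<Sum>i = 1..n. \<nu> i) + t"
proof -
  have "(\<Sum>i = 1..n. (\<nu>(Suc n := t)) i) = (\<Sum>i = 1..n. \<nu> i)"
    by (intro sum.cong) auto
  then show ?thesis by (simp del: fun_upd_apply) simp
qed

lemma tuple_count_0: "tuple_count 0 w k = (if k = 0 then 1 else 0)"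
  by (simp add: tuple_count_def)

lemma tuple_count_Suc:
  "tuple_count (Suc n) w k = (\<Sum>t = 0..int (w (Suc n)). tuple_count n w (k - t))"
proof -
  have ins: "{1..Suc n} = insert (Suc n) {1..n}" by auto
  have "tuple_count (Suc n) w k = card {\<nu> \<in> Pi\<^sub>E (insert (Suc n) {1..n}) (\<lambda>i. {0..int (w i)}).
      (\<Sum>i = 1..Suc n. \<nu> i) = k}"
    unfolding tuple_count_def ins ..
  also have "\<dots> = (\<Sum>t = 0..int (w (Suc n)). card {\<nu> \<in> Pi\<^sub>E {1..n} (\<lambda>i. {0..int (w i)}).
      (\<Sum>i = 1..Suc n. (\<nu>(Suc n := t)) i) = k})"
    by (intro card_PiE_insert_filter) auto
  also have "\<dots> = (\<Sum>t = 0..int (w (Suc n)). tuple_count n w (k - t))"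
    unfolding tuple_count_def sum_upd_Suc by (simp add: eq_diff_eq)
  finally show ?thesis .
qed

lemma tuple_count_neg: "k < 0 \<Longrightarrow> tuple_count n w k = 0"
  by (induction n arbitrary: k) (auto simp: tuple_count_0 tuple_count_Suc)

text \<open>Replacing each \<open>\<nu> i\<close> by \<open>w i - \<nu> i\<close> preserves the box
  and complements the sum; the induction reflects one coordinate at a time.\<close>

lemma tuple_count_sym: "tuple_count n w (int (\<Sum>i = 1..n. w i) - k) = tuple_count n w k"
proof (induction n arbitrary: k)
  case 0
  then show ?case by (simp add: tuple_count_0)
next
  case (Suc n)
  let ?W = "int (\<Sum>i = 1..n. w i)" and ?v = "int (w (Suc n))"
  have "tuple_count (Suc n) w (int (\<Sum>i = 1..Suc n. w i) - k)
      = (\<Sum>t = 0..?v. tuple_count n w (?W + ?v - k - t))"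
    unfolding tuple_count_Suc by simp
  also have "\<dots> = (\<Sum>t = 0..?v. tuple_count n w (?W - (k - t)))"
    by (rule sum.reindex_bij_witness[of _ "\<lambda>t. ?v - t" "\<lambda>t. ?v - t"]) (auto simp: algebra_simps)
  also have "\<dots> = tuple_count (Suc n) w k"
    unfolding tuple_count_Suc Suc.IH ..
  finally show ?case .
qed

lemma sum_diff_telescope_int:
  fixes F :: "int \<Rightarrow> 'a::ab_group_add"
  shows "(\<Sum>t = 0..<int m. F (k - t) - F (k - t - 1)) = F k - F (k - int m)"
proof (induction m)
  case (Suc m)
  have "{0..<int (Suc m)} = insert (int m) {0..<int m}" by auto
  then show ?case using Suc by (simp add: algebra_simps)
qed simp

text \<open>Lowering \<open>k\<close> by one slides a window of \<open>w (Suc n) + 1\<close>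
  consecutive arguments, so only its two end terms survive. On generating functions this is
  multiplication by 1 - x.\<close>

lemma tuple_count_Suc_diff:
  "int (tuple_count (Suc n) w k) - int (tuple_count (Suc n) w (k - 1))
    = int (tuple_count n w k) - int (tuple_count n w (k - int (w (Suc n)) - 1))"
proof -
  have "{0..int (w (Suc n))} = {0..<int (Suc (w (Suc n)))}" by auto
  moreover have "k - 1 - t = k - t - 1" for t by simp
  ultimately have "int (tuple_count (Suc n) w k) - int (tuple_count (Suc n) w (k - 1))
      = (\<Sum>t = 0..<int (Suc (w (Suc n))).
           int (tuple_count n w (k - t)) - int (tuple_count n w (k - t - 1)))"
    by (simp only: tuple_count_Suc of_nat_sum sum_subtractf)
  also have "\<dots> = int (tuple_count n w k) - int (tuple_count n w (k - int (Suc (w (Suc n)))))"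
    by (rule sum_diff_telescope_int)
  finally show ?thesis by (simp add: algebra_simps)
qed

section \<open>Inclusion--exclusion\<close>

text \<open>The coefficient of \<open>x ^ k\<close> in \<open>(1 - x) ^ (- m)\<close>.\<close>

definition geom_coeff :: "nat \<Rightarrow> int \<Rightarrow> int" where
  "geom_coeff m k =
     (if m = 0 then if k = 0 then 1 else 0 else binom (k + int m - 1) (int m - 1))"

lemma binom_of_nat: "binom (int a) (int b) = int (a choose b)"
  by (simp add: binom_def binomial_eq_0)

lemma geom_coeff_neg: "k < 0 \<Longrightarrow> geom_coeff m k = 0"
  by (auto simp: geom_coeff_def binom_def)

text \<open>Pascal's rule, that is, (1 - x) * (1 - x)^(-(m + 1)) = (1 - x)^(-m) on
  coefficients.\<close>

lemma geom_coeff_diff: "geom_coeff (Suc m) k - geom_coeff (Suc m) (k - 1) = geom_coeff m k"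
proof (cases "m = 0 \<or> k \<le> 0")
  case True
  then show ?thesis
    by (cases "k < 0"; cases "k = 0") (auto simp: geom_coeff_def binom_def nat_add_distrib nat_diff_distrib)
next
  case False
  then obtain p q where m: "m = Suc p" and k: "k = int (Suc q)"
    by (metis not0_implies_Suc not_le pos_int_cases less_numeral_extra(3))
  have "geom_coeff (Suc m) k = binom (int (Suc (Suc (p + q)))) (int (Suc p))"
    "geom_coeff (Suc m) (k - 1) = binom (int (Suc (p + q))) (int (Suc p))"
    "geom_coeff m k = binom (int (Suc (p + q))) (int p)"
    by (simp_all add: geom_coeff_def m k algebra_simps)
  then show ?thesis by (simp add: binom_of_nat del: of_nat_Suc)
qed

text \<open>The coefficient of x^k in the product of the 1 - x^(w_i + 1), divided by (1 - x)^m. The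
  exponent \<open>m\<close> is kept apart from \<open>n\<close> because differences in
  \<open>k\<close> lower \<open>m\<close> alone.\<close>

definition incl_excl :: "nat \<Rightarrow> nat \<Rightarrow> (nat \<Rightarrow> nat) \<Rightarrow> int \<Rightarrow> int" where
  "incl_excl n m w k =
     (\<Sum>J\<in>Pow {1..n}. (- 1) ^ card J * geom_coeff m (k - int (\<Sum>j\<in>J. w j) - int (card J)))"

lemma incl_excl_diff: "incl_excl n (Suc m) w k - incl_excl n (Suc m) w (k - 1) = incl_excl n m w k"
proof -
  have "k - 1 - a - b = k - a - b - 1" for a b :: int by simp
  then show ?thesis
    unfolding incl_excl_def
    by (simp only: sum_subtractf[symmetric] right_diff_distrib[symmetric] geom_coeff_diff)
qed

lemma incl_excl_neg: "k < 0 \<Longrightarrow> incl_excl n m w k = 0"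
  unfolding incl_excl_def by (intro sum.neutral ballI) (simp add: geom_coeff_neg del: of_nat_sum)

text \<open>Subsets containing \<open>Suc n\<close> contribute with opposite sign and a shift by
  \<open>w (Suc n) + 1\<close>: one more numerator is multiplied in.\<close>

lemma incl_excl_Suc:
  "incl_excl (Suc n) m w k = incl_excl n m w k - incl_excl n m w (k - int (w (Suc n)) - 1)"
proof -
  let ?f = "\<lambda>J. (- 1) ^ card J * geom_coeff m (k - int (\<Sum>j\<in>J. w j) - int (card J))"
  have ins: "{1..Suc n} = insert (Suc n) {1..n}" by auto
  have inj: "inj_on (insert (Suc n)) (Pow {1..n})"
    by (rule inj_onI) (metis Pow_iff atLeastAtMost_iff insert_ident not_less_eq_eq order_refl subsetD)
  have "incl_excl (Suc n) m w k = sum ?f (Pow {1..n}) + sum ?f (insert (Suc n) ` Pow {1..n})"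
    unfolding incl_excl_def ins Pow_insert by (rule sum.union_disjoint) auto
  also have "sum ?f (insert (Suc n) ` Pow {1..n})
      = (\<Sum>J\<in>Pow {1..n}. - ((- 1) ^ card J *
          geom_coeff m (k - int (w (Suc n)) - 1 - int (\<Sum>j\<in>J. w j) - int (card J))))"
  proof (subst sum.reindex[OF inj], rule sum.cong[OF refl])
    fix J assume J: "J \<in> Pow {1..n}"
    then have "finite J" "Suc n \<notin> J" by (auto intro: finite_subset)
    then show "(?f \<circ> insert (Suc n)) J = - ((- 1) ^ card J *
          geom_coeff m (k - int (w (Suc n)) - 1 - int (\<Sum>j\<in>J. w j) - int (card J)))"
      by (simp add: algebra_simps)
  qed
  finally show ?thesis by (simp add: incl_excl_def sum_negf)
qed

text \<open>Both sides vanish for negative \<open>k\<close>, and their differences in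
  \<open>k\<close> reduce in the same way to the case \<open>n\<close>.\<close>

lemma tuple_count_eq_incl_excl: "int (tuple_count n w k) = incl_excl n n w k"
proof (induction n arbitrary: k)
  case 0
  then show ?case by (simp add: tuple_count_0 incl_excl_def geom_coeff_def)
next
  case (Suc n)
  have diff: "int (tuple_count (Suc n) w k) - int (tuple_count (Suc n) w (k - 1))
      = incl_excl (Suc n) (Suc n) w k - incl_excl (Suc n) (Suc n) w (k - 1)" for k
    by (simp only: tuple_count_Suc_diff incl_excl_diff Suc.IH incl_excl_Suc[of n n])
  show ?case
  proof (cases "k < 0")
    case True
    then show ?thesis by (simp add: tuple_count_neg incl_excl_neg)
  next
    case False
    \<comment> \<open>Starting at -1, where both sides are 0, lets \<open>diff\<close> produce the
      value at 0 as well.\<close>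
    then have "- 1 \<le> k" by simp
    then show ?thesis
    proof (induction k rule: int_ge_induct)
      case base
      then show ?case by (simp add: tuple_count_neg incl_excl_neg)
    next
      case (step k)
      then show ?case using diff[of "k + 1"] by simp
    qed
  qed
qed

section \<open>Ballot tuples\<close>

text \<open>
  If \<open>\<nu> i\<close> is the number of entries \<open>i\<close> in the second row of a two-row tableau, then the last
  condition says that the entries at most \<open>i\<close> of the second row do not outnumber the entries
  less than \<open>i\<close> of the first row. This is column strictness.
\<close>

definition ballot_tuples :: "nat \<Rightarrow> (nat \<Rightarrow> nat) \<Rightarrow> int \<Rightarrow> (nat \<Rightarrow> int) set" where
  "ballot_tuples n w k = {\<nu> \<in> (\<Pi>\<^sub>E i\<in>{1..n}. {0..int (w i)}). (\<Sum>i = 1..n. \<nu> i) = k \<and>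
     (\<forall>i<n. (\<Sum>j = 1..Suc i. \<nu> j) + (\<Sum>j = 1..i. \<nu> j) \<le> int (\<Sum>j = 1..i. w j))}"

text \<open>Only the condition for index \<open>n\<close> is new. With last entry \<open>t\<close>
  the others sum to \<open>k - t\<close>, so it reads 2 (k - t) + t \<le> w_1 + ... + w_n.\<close>

lemma card_ballot_tuples_Suc:
  "card (ballot_tuples (Suc n) w k) = (\<Sum>t = 0..int (w (Suc n)).
     if 2 * k - t \<le> int (\<Sum>i = 1..n. w i) then card (ballot_tuples n w (k - t)) else 0)"
proof -
  let ?W = "int (\<Sum>i = 1..n. w i)"
  let ?P = "\<lambda>m \<nu>. (\<forall>i<m. (\<Sum>j = 1..Suc i. \<nu> j) + (\<Sum>j = 1..i. \<nu> j) \<le> int (\<Sum>j = 1..i. w j))"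
  have ins: "{1..Suc n} = insert (Suc n) {1..n}" by auto
  have low: "(\<Sum>j = 1..i. (\<nu>(Suc n := t)) j) = (\<Sum>j = 1..i. \<nu> j)" if "i \<le> n"
    for i t and \<nu> :: "nat \<Rightarrow> int"
    using that by (intro sum.cong) auto
  have P: "?P (Suc n) (\<nu>(Suc n := t)) \<longleftrightarrow> ?P n \<nu> \<and> 2 * (\<Sum>i = 1..n. \<nu> i) + t \<le> ?W" for \<nu> t
  proof -
    have "?P n (\<nu>(Suc n := t)) \<longleftrightarrow> ?P n \<nu>"
      using low[of _ \<nu> t] by (metis (no_types, lifting) Suc_leI less_imp_le_nat)
    then show ?thesis
      unfolding All_less_Suc sum_upd_Suc low[OF order_refl] by auto
  qed
  have "card (ballot_tuples (Suc n) w k)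
      = card {\<nu> \<in> Pi\<^sub>E (insert (Suc n) {1..n}) (\<lambda>i. {0..int (w i)}).
          (\<Sum>i = 1..Suc n. \<nu> i) = k \<and> ?P (Suc n) \<nu>}"
    unfolding ballot_tuples_def ins ..
  also have "\<dots> = (\<Sum>t = 0..int (w (Suc n)). card {\<nu> \<in> Pi\<^sub>E {1..n} (\<lambda>i. {0..int (w i)}).
      (\<Sum>i = 1..Suc n. (\<nu>(Suc n := t)) i) = k \<and> ?P (Suc n) (\<nu>(Suc n := t))})"
    by (intro card_PiE_insert_filter) auto
  also have "\<dots> = (\<Sum>t = 0..int (w (Suc n)).
      if 2 * k - t \<le> ?W then card (ballot_tuples n w (k - t)) else 0)"
  proof (rule sum.cong[OF refl])
    fix t
    have "{\<nu> \<in> Pi\<^sub>E {1..n} (\<lambda>i. {0..int (w i)}).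
        (\<Sum>i = 1..Suc n. (\<nu>(Suc n := t)) i) = k \<and> ?P (Suc n) (\<nu>(Suc n := t))}
      = (if 2 * k - t \<le> ?W then ballot_tuples n w (k - t) else {})"
      unfolding P sum_upd_Suc ballot_tuples_def by auto
    then show "card {\<nu> \<in> Pi\<^sub>E {1..n} (\<lambda>i. {0..int (w i)}).
        (\<Sum>i = 1..Suc n. (\<nu>(Suc n := t)) i) = k \<and> ?P (Suc n) (\<nu>(Suc n := t))}
      = (if 2 * k - t \<le> ?W then card (ballot_tuples n w (k - t)) else 0)"
      by simp
  qed
  finally show ?thesis .
qed

text \<open>The bound says that a second row of length \<open>k\<close> is no longer than a first
  row of length |w| - k. In the induction it keeps all excluded values of \<open>t\<close> within
  the range of summation.\<close>

lemma card_ballot_tuples: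
  assumes "2 * k \<le> int (\<Sum>i = 1..n. w i)"
  shows "int (card (ballot_tuples n w k)) = int (tuple_count n w k) - int (tuple_count n w (k - 1))"
  using assms
proof (induction n arbitrary: k)
  case 0
  then show ?case by (auto simp: ballot_tuples_def tuple_count_0)
next
  case (Suc n)
  let ?W = "int (\<Sum>i = 1..n. w i)" and ?v = "int (w (Suc n))"
  define D where "D t = int (tuple_count n w (k - t)) - int (tuple_count n w (k - t - 1))" for t
  \<comment> \<open>The ballot condition excludes exactly the \<open>t\<close> below
    \<open>2 * k - ?W\<close>; truncation at 0 covers the case where nothing is excluded.\<close>
  define m where "m = nat (2 * k - ?W)"
  have le: "2 * k \<le> ?W + ?v" using Suc.prems by simp
  have "int (card (ballot_tuples (Suc n) w k))
      = (\<Sum>t = 0..?v. if 2 * k - t \<le> ?W then int (card (ballot_tuples n w (k - t))) else 0)"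
    unfolding card_ballot_tuples_Suc of_nat_sum by (intro sum.cong) auto
  \<comment> \<open>The induction hypothesis applies to the surviving terms, since 2 (k - t) \<le> 2
    k - t \<le> ?W.\<close>
  also have "\<dots> = (\<Sum>t = 0..?v. if 2 * k - t \<le> ?W then D t else 0)"
    unfolding D_def using Suc.IH by (intro sum.cong) auto
  also have "\<dots> = sum D {int m..?v}"
    unfolding sum.inter_filter[symmetric, OF finite_atLeastAtMost_int]
    by (intro sum.cong) (auto simp: m_def)
  also have "\<dots> = sum D {0..<int m} + sum D {int m..?v}"
  proof -
    text \<open>The terms excluded by the ballot condition cancel, since \<open>tuple_count n w\<close> is symmetric.\<close>
    have "sum D {0..<int m} = int (tuple_count n w k) - int (tuple_count n w (k - int m))"
      unfolding D_def by (rule sum_diff_telescope_int)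
    also have "\<dots> = 0"
    proof (cases "2 * k \<le> ?W")
      case False
      then have "k - int m = ?W - k" by (simp add: m_def)
      then show ?thesis by (simp only: tuple_count_sym)
    qed (simp add: m_def)
    finally show ?thesis by simp
  qed
  also have "\<dots> = sum D {0..?v}"
  proof -
    have "{0..?v} = {0..<int m} \<union> {int m..?v}" using le by (auto simp: m_def)
    then show ?thesis by (metis sum.union_disjoint finite_atLeastAtMost_int
          finite_atLeastLessThan_int ivl_disj_int_two(7))
  qed
  also have "\<dots> = int (tuple_count (Suc n) w k) - int (tuple_count (Suc n) w (k - 1))"
    unfolding D_def tuple_count_Suc of_nat_sum sum_subtractf by (simp add: algebra_simps)
  finally show ?case .
qed

section \<open>Two-row tableaux\<close>

definition row_count :: "nat \<Rightarrow> (nat \<Rightarrow> nat) \<Rightarrow> nat \<Rightarrow> nat" where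
  "row_count h g i = card {c. c < h \<and> g c = i}"

lemma sum_row_count:
  assumes "\<And>c. c < h \<Longrightarrow> 1 \<le> g c"
  shows "(\<Sum>j = 1..i. row_count h g j) = card {c. c < h \<and> g c \<le> i}"
proof (induction i)
  case 0
  have "{c. c < h \<and> g c \<le> 0} = {}" using assms by fastforce
  then show ?case by simp
next
  case (Suc i)
  have "{c. c < h \<and> g c \<le> Suc i} = {c. c < h \<and> g c \<le> i} \<union> {c. c < h \<and> g c = Suc i}" by auto
  then have "card {c. c < h \<and> g c \<le> Suc i} = card {c. c < h \<and> g c \<le> i} + row_count h g (Suc i)"
    unfolding row_count_def by (simp add: card_Un_disjoint disjoint_iff)
  then show ?case using Suc by simp
qed

text \<open>In a weakly increasing row the columns with entry at most \<open>x\<close> form an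
  initial segment.\<close>

lemma mono_on_le_iff_less_card:
  fixes g :: "nat \<Rightarrow> 'a::linorder"
  assumes "mono_on {..<h} g" "c < h"
  shows "g c \<le> x \<longleftrightarrow> c < card {c. c < h \<and> g c \<le> x}"
proof
  assume "g c \<le> x"
  then have "{..c} \<subseteq> {c. c < h \<and> g c \<le> x}"
    using assms(2) mono_onD[OF assms(1), of _ c] by (auto intro: order_trans)
  then have "card {..c} \<le> card {c. c < h \<and> g c \<le> x}" by (intro card_mono) auto
  then show "c < card {c. c < h \<and> g c \<le> x}" by simp
next
  assume less: "c < card {c. c < h \<and> g c \<le> x}"
  show "g c \<le> x"
  proof (rule ccontr)
    assume "\<not> g c \<le> x"
    then have "{c. c < h \<and> g c \<le> x} \<subseteq> {..<c}"
      using assms(2) mono_onD[OF assms(1), of c] by (force simp: not_less[symmetric])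
    then have "card {c. c < h \<and> g c \<le> x} \<le> card {..<c}" by (intro card_mono) auto
    then show False using less by simp
  qed
qed

lemma row_le_iff:
  assumes "mono_on {..<h} g" "\<And>c. c < h \<Longrightarrow> 1 \<le> g c" "c < h"
  shows "g c \<le> i \<longleftrightarrow> c < (\<Sum>j = 1..i. row_count h g j)"
proof -
  have "(\<Sum>j = 1..i. row_count h g j) = card {c. c < h \<and> g c \<le> i}"
    using assms(2) by (rule sum_row_count)
  then show ?thesis using mono_on_le_iff_less_card[OF assms(1,3)] by simp
qed

text \<open>The weakly increasing row whose number of entries at most \<open>i\<close> is \<open>S i\<close>.\<close>

definition row_of :: "(nat \<Rightarrow> nat) \<Rightarrow> nat \<Rightarrow> nat" where
  "row_of S c = (LEAST i. c < S i)"

context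
  fixes S :: "nat \<Rightarrow> nat" and n h :: nat
  assumes mono: "mono S" and S0: "S 0 = 0" and Sn: "S n = h"
begin

text \<open>\<open>S n = h\<close> makes the minimum exist for \<open>c < h\<close>, and
  monotonicity of \<open>S\<close> gives the forward direction. Range, order and counts of the row
  are read off from this equivalence.\<close>

lemma row_of_le_iff:
  assumes "c < h"
  shows "row_of S c \<le> i \<longleftrightarrow> c < S i"
proof
  assume "row_of S c \<le> i"
  moreover have "c < S (row_of S c)"
    unfolding row_of_def using assms Sn by (metis LeastI)
  ultimately show "c < S i" using monoD[OF mono, of "row_of S c" i] by simp
next
  assume "c < S i"
  then show "row_of S c \<le> i" unfolding row_of_def by (rule Least_le)
qed

lemma row_of_range: "c < h \<Longrightarrow> row_of S c \<in> {1..n}"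
  using row_of_le_iff[of c 0] row_of_le_iff[of c n] S0 Sn by simp

lemma mono_on_row_of: "mono_on {..<h} (row_of S)"
proof (rule mono_onI)
  fix c d assume "c \<in> {..<h}" "d \<in> {..<h}" "c \<le> d"
  then show "row_of S c \<le> row_of S d"
    using row_of_le_iff[of c "row_of S d"] row_of_le_iff[of d "row_of S d"] by simp
qed

lemma sum_row_count_row_of:
  assumes "i \<le> n"
  shows "(\<Sum>j = 1..i. row_count h (row_of S) j) = S i"
proof -
  have "S i \<le> h" using monoD[OF mono assms] Sn by simp
  then have "{c. c < h \<and> row_of S c \<le> i} = {..<S i}" by (auto simp: row_of_le_iff)
  moreover have "1 \<le> row_of S c" if "c < h" for c using row_of_range[OF that] by simp
  ultimately show ?thesis by (simp add: sum_row_count del: One_nat_def)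
qed

lemma row_count_row_of:
  assumes "Suc i \<le> n"
  shows "row_count h (row_of S) (Suc i) = S (Suc i) - S i"
  using sum_row_count_row_of[OF assms] sum_row_count_row_of[of i] assms by simp

end

section \<open>Tableaux of shape \<open>[h, h]\<close> in terms of their rows\<close>

lemma cells_two_row: "cells [h, h] = {0, 1} \<times> {..<h}"
  by (auto simp: cells_def less_Suc_eq nth_Cons split: nat.splits)

lemma ssyt_two_row:
  "ssyt [h, h] T \<longleftrightarrow> T \<in> {0, 1} \<times> {..<h} \<rightarrow>\<^sub>E {1..} \<and>
     (\<forall>r\<in>{0, 1}. mono_on {..<h} (\<lambda>c. T (r, c))) \<and> (\<forall>c<h. T (0, c) < T (1, c))"
proof -
  have "(\<forall>r\<in>{0, 1}. mono_on {..<h} (\<lambda>c. T (r, c))) \<longleftrightarrow> (\<forall>r c c'. (r, c) \<in> {0, 1} \<times> {..<h} \<and>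
      (r, c') \<in> {0, 1} \<times> {..<h} \<and> c < c' \<longrightarrow> T (r, c) \<le> T (r, c'))"
    unfolding mono_on_def le_less[of _ "_ :: nat"] mem_Times_iff fst_conv snd_conv lessThan_iff by blast
  moreover have "(\<forall>c<h. T (0, c) < T (1, c)) \<longleftrightarrow> (\<forall>r r' c. (r, c) \<in> {0, 1} \<times> {..<h} \<and>
      (r', c) \<in> {0, 1} \<times> {..<h} \<and> r < r' \<longrightarrow> T (r, c) < T (r', c))"
    by auto
  ultimately show ?thesis unfolding ssyt_def cells_two_row by (simp only:)
qed

lemma has_content_two_row:
  "has_content [h, h] n w T \<longleftrightarrow> (\<forall>r\<in>{0, 1}. \<forall>c<h. T (r, c) \<in> {1..n}) \<and>
     (\<forall>i\<in>{1..n}. row_count h (\<lambda>c. T (0, c)) i + row_count h (\<lambda>c. T (1, c)) i = w i)"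
proof -
  have "card {x \<in> {0, 1} \<times> {..<h}. T x = i}
      = row_count h (\<lambda>c. T (0, c)) i + row_count h (\<lambda>c. T (1, c)) i" for i
  proof -
    have "{x \<in> {0, 1} \<times> {..<h}. T x = i}
      = Pair 0 ` {c. c < h \<and> T (0, c) = i} \<union> Pair 1 ` {c. c < h \<and> T (1, c) = i}"
      by auto
    then show ?thesis
      unfolding row_count_def
      by (simp only:) (subst card_Un_disjoint, auto simp: card_image inj_on_def)
  qed
  moreover have "T ` ({0, 1} \<times> {..<h}) \<subseteq> {1..n} \<longleftrightarrow> (\<forall>r\<in>{0, 1}. \<forall>c<h. T (r, c) \<in> {1..n})"
    unfolding image_subset_iff by blast
  ultimately show ?thesis unfolding has_content_def cells_two_row by (simp only:)
qed

section \<open>The bijection between two-row tableaux and ballot tuples\<close>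

definition second_row_content :: "nat \<Rightarrow> nat \<Rightarrow> (nat \<times> nat \<Rightarrow> nat) \<Rightarrow> nat \<Rightarrow> int" where
  "second_row_content n h T = (\<lambda>i\<in>{1..n}. int (row_count h (\<lambda>c. T (1, c)) i))"

lemma sum_second_row_content:
  assumes "i \<le> n"
  shows "(\<Sum>j = 1..i. second_row_content n h T j) = int (\<Sum>j = 1..i. row_count h (\<lambda>c. T (1, c)) j)"
  unfolding of_nat_sum second_row_content_def using assms by (intro sum.cong) auto

lemma sum_row_counts_two_row:
  assumes "has_content [h, h] n w T" "i \<le> n"
  shows "(\<Sum>j = 1..i. row_count h (\<lambda>c. T (0, c)) j) + (\<Sum>j = 1..i. row_count h (\<lambda>c. T (1, c)) j)
    = (\<Sum>j = 1..i. w j)"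
  unfolding sum.distrib[symmetric]
  using assms unfolding has_content_two_row by (intro sum.cong) auto

lemma second_row_content_in_ballot_tuples:
  assumes T: "ssyt [h, h] T" and cont: "has_content [h, h] n w T"
  shows "second_row_content n h T \<in> ballot_tuples n w (int h)"
proof -
  let ?g = "\<lambda>r c. T (r, c)"
  have range: "T (r, c) \<in> {1..n}" if "r \<in> {0, 1}" "c < h" for r c
    using cont that unfolding has_content_two_row by blast
  have "row_count h (?g 1) i \<le> w i" if "i \<in> {1..n}" for i
    using cont that unfolding has_content_two_row by (metis le_add2)
  then have "second_row_content n h T \<in> (\<Pi>\<^sub>E i\<in>{1..n}. {0..int (w i)})"
    by (auto simp: second_row_content_def)
  moreover have "(\<Sum>j = 1..n. second_row_content n h T j) = int h"
  proof -
    have "{c. c < h \<and> T (1, c) \<le> n} = {..<h}" using range[of 1] by auto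
    then show ?thesis
      using range[of 1] by (simp add: sum_second_row_content sum_row_count del: One_nat_def of_nat_sum)
  qed
  moreover have "(\<Sum>j = 1..Suc i. second_row_content n h T j)
      + (\<Sum>j = 1..i. second_row_content n h T j) \<le> int (\<Sum>j = 1..i. w j)" if "i < n" for i
  proof -
    \<comment> \<open>Column strictness: below an entry greater than \<open>i\<close> there is none
      that is at most \<open>Suc i\<close>.\<close>
    have "{c. c < h \<and> T (1, c) \<le> Suc i} \<subseteq> {c. c < h \<and> T (0, c) \<le> i}"
      using T unfolding ssyt_two_row by fastforce
    then have "card {c. c < h \<and> T (1, c) \<le> Suc i} \<le> card {c. c < h \<and> T (0, c) \<le> i}"
      by (intro card_mono) auto
    then have "(\<Sum>j = 1..Suc i. row_count h (?g 1) j) \<le> (\<Sum>j = 1..i. row_count h (?g 0) j)"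
      using range by (subst (1 2) sum_row_count) auto
    \<comment> \<open>Adding the second-row count up to \<open>i\<close> to both sides turns the
      first-row count into a partial sum of \<open>w\<close>.\<close>
    then show ?thesis
      using sum_row_counts_two_row[OF cont, of i] that
      unfolding sum_second_row_content[OF Suc_leI[OF that]]
        sum_second_row_content[OF less_imp_le[OF that]] by linarith
  qed
  ultimately show ?thesis unfolding ballot_tuples_def by blast
qed

text \<open>Together with \<open>w\<close>, the second-row counts fix the first-row counts, and a
  weakly increasing row is determined by its counts.\<close>

lemma inj_on_second_row_content:
  "inj_on (second_row_content n h) {T. ssyt [h, h] T \<and> has_content [h, h] n w T}"
proof (rule inj_onI, clarify)
  fix T U
  assume T: "ssyt [h, h] T" "has_content [h, h] n w T"
    and U: "ssyt [h, h] U" "has_content [h, h] n w U"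
    and eq: "second_row_content n h T = second_row_content n h U"
  have sums: "(\<Sum>j = 1..i. row_count h (\<lambda>c. T (r, c)) j) = (\<Sum>j = 1..i. row_count h (\<lambda>c. U (r, c)) j)"
    if "i \<le> n" "r \<in> {0, 1}" for i r
  proof -
    have "(\<Sum>j = 1..i. row_count h (\<lambda>c. T (1, c)) j) = (\<Sum>j = 1..i. row_count h (\<lambda>c. U (1, c)) j)"
      using sum_second_row_content[OF that(1), of h T] sum_second_row_content[OF that(1), of h U] eq
      by (simp only: of_nat_eq_iff)
    then show ?thesis
      using sum_row_counts_two_row[OF T(2) that(1)] sum_row_counts_two_row[OF U(2) that(1)] that(2)
      by auto
  qed
  have le_iff: "V (r, c) \<le> i \<longleftrightarrow> c < (\<Sum>j = 1..i. row_count h (\<lambda>c. V (r, c)) j)"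
    if "ssyt [h, h] V" "r \<in> {0, 1}" "c < h" for V r c i
    using that unfolding ssyt_two_row by (intro row_le_iff) (auto simp: PiE_iff)
  have "T x = U x" if x: "x \<in> {0, 1} \<times> {..<h}" for x
  proof -
    obtain r c where rc: "x = (r, c)" "r \<in> {0, 1}" "c < h" using x by auto
    \<comment> \<open>Thresholds up to \<open>n\<close> suffice because all entries are at most
      \<open>n\<close>: take \<open>i\<close> to be \<open>T x\<close> and
      \<open>U x\<close>.\<close>
    have "T x \<le> i \<longleftrightarrow> U x \<le> i" if "i \<le> n" for i
      using le_iff[OF T(1) rc(2,3), of i] le_iff[OF U(1) rc(2,3), of i] sums[OF that rc(2)] rc(1)
      by simp
    moreover have "T x \<le> n" "U x \<le> n"
      using T(2) U(2) rc unfolding has_content_two_row by auto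
    ultimately show ?thesis by (metis order_antisym order_refl)
  qed
  then show "T = U"
    using T(1) U(1) unfolding ssyt_two_row by (meson PiE_ext)
qed

text \<open>The preimage has rows with letter counts \<open>w i - \<nu> i\<close> and
  \<open>\<nu> i\<close>, rebuilt from their partial sums by \<open>row_of\<close>.\<close>

lemma ballot_tuples_subset_second_row_content:
  assumes W: "(\<Sum>i = 1..n. w i) = 2 * h"
  shows "ballot_tuples n w (int h)
    \<subseteq> second_row_content n h ` {T. ssyt [h, h] T \<and> has_content [h, h] n w T}"
proof
  fix \<nu> assume nu: "\<nu> \<in> ballot_tuples n w (int h)"
  \<comment> \<open>Extending by 0 outside \<open>{1..n}\<close> makes
    \<open>\<mu> i \<le> v i\<close> hold for every \<open>i\<close>, so the subtraction in
    \<open>S\<close> is exact.\<close>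
  define \<mu> where "\<mu> i = (if i \<in> {1..n} then nat (\<nu> i) else 0)" for i
  define v where "v i = (if i \<in> {1..n} then w i else 0)" for i
  have nu_mu: "\<nu> i = int (\<mu> i)" if "i \<in> {1..n}" for i
    using nu that unfolding ballot_tuples_def \<mu>_def by (auto simp: PiE_iff)
  have mu_le: "\<mu> i \<le> v i" for i
    using nu unfolding ballot_tuples_def \<mu>_def v_def by (fastforce simp: PiE_iff nat_le_iff)
  have sum_nu: "(\<Sum>j = 1..i. \<nu> j) = int (\<Sum>j = 1..i. \<mu> j)" if "i \<le> n" for i
    unfolding of_nat_sum using that by (intro sum.cong) (auto simp: nu_mu)
  have sum_w: "(\<Sum>j = 1..i. w j) = (\<Sum>j = 1..i. v j)" if "i \<le> n" for i
    using that by (intro sum.cong) (auto simp: v_def)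
  define S where "S r i = (\<Sum>j = 1..i. if r = 0 then v j - \<mu> j else \<mu> j)" for r i :: nat
  have S01: "S 0 i + S 1 i = (\<Sum>j = 1..i. v j)" for i
    unfolding S_def sum.distrib[symmetric] using mu_le by (intro sum.cong) auto
  have S1n: "S 1 n = h"
    using nu sum_nu[of n] unfolding ballot_tuples_def S_def by (simp del: of_nat_sum)
  have S0n: "S 0 n = h"
    using S01[of n] S1n W sum_w[of n] by simp
  have S: "mono (S r)" "S r 0 = 0" "S r n = h" if "r \<in> {0, 1}" for r
    using that S0n S1n by (auto simp: S_def mono_iff_le_Suc)
  \<comment> \<open>Cancelling \<open>S 1 i\<close> by means of \<open>S01\<close> turns the ballot
    inequality into a comparison of the two rows.\<close>
  have ballot: "S 1 (Suc i) \<le> S 0 i" if "i < n" for i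
  proof -
    have "(\<Sum>j = 1..Suc i. \<nu> j) + (\<Sum>j = 1..i. \<nu> j) \<le> int (\<Sum>j = 1..i. w j)"
      using nu that unfolding ballot_tuples_def by blast
    then have "S 1 (Suc i) + S 1 i \<le> (\<Sum>j = 1..i. v j)"
      unfolding sum_nu[OF Suc_leI[OF that]] sum_nu[OF less_imp_le[OF that]]
        sum_w[OF less_imp_le[OF that]] S_def by (simp only: of_nat_add[symmetric] of_nat_le_iff one_neq_zero if_False)
    then show ?thesis using S01[of i] by simp
  qed
  define T where "T = (\<lambda>(r, c)\<in>{0, 1} \<times> {..<h}. row_of (S r) c)"
  have T_row: "T (r, c) = row_of (S r) c" if "r \<in> {0, 1}" "c < h" for r c
    using that by (auto simp: T_def)
  have T_count: "row_count h (\<lambda>c. T (r, c)) i = (if r = 0 then w i - \<mu> i else \<mu> i)"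
    if r: "r \<in> {0, 1}" and i: "i \<in> {1..n}" for r i
  proof -
    obtain p where p: "i = Suc p" "Suc p \<le> n" using i by (cases i) auto
    have "row_count h (\<lambda>c. T (r, c)) i = row_count h (row_of (S r)) i"
      unfolding row_count_def using T_row[OF r] by (metis (lifting))
    also have "\<dots> = S r (Suc p) - S r p"
      unfolding p(1) by (rule row_count_row_of[OF S[OF r] p(2)])
    also have "\<dots> = (if r = 0 then w i - \<mu> i else \<mu> i)"
      using i unfolding S_def p(1) by (simp add: v_def)
    finally show ?thesis .
  qed
  have range: "T (r, c) \<in> {1..n}" if "r \<in> {0, 1}" "c < h" for r c
    unfolding T_row[OF that] by (rule row_of_range[OF S[OF that(1)] that(2)])
  have "T \<in> {0, 1} \<times> {..<h} \<rightarrow>\<^sub>E {1..}"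
    using range unfolding T_def by (intro restrict_PiE_iff[THEN iffD2]) (auto simp del: One_nat_def)
  moreover have "mono_on {..<h} (\<lambda>c. T (r, c))" if "r \<in> {0, 1}" for r
    using mono_on_row_of[OF S[OF that]] T_row[OF that] by (simp add: mono_on_def)
  moreover have "T (0, c) < T (1, c)" if c: "c < h" for c
  proof -
    \<comment> \<open>If the lower entry is \<open>Suc p\<close>, then c < S 1 (Suc p) \<le> S 0 p,
      so the upper entry is at most \<open>p\<close>.\<close>
    obtain p where p: "T (1, c) = Suc p" "p < n"
      using range[of 1 c] c by (cases "T (1, c)") auto
    have "c < S 1 (Suc p)"
      using row_of_le_iff[OF S, of 1 c "Suc p"] T_row[of 1 c] p c by simp
    then have "c < S 0 p" using ballot[OF p(2)] by simp
    then show ?thesis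
      using row_of_le_iff[OF S, of 0 c p] T_row[of 0 c] p c by simp
  qed
  ultimately have "ssyt [h, h] T" unfolding ssyt_two_row by blast
  moreover have "has_content [h, h] n w T"
    unfolding has_content_two_row
  proof (intro conjI ballI allI impI range)
    fix i assume i: "i \<in> {1..n}"
    then have "\<mu> i \<le> w i" using mu_le[of i] by (simp add: v_def)
    then show "row_count h (\<lambda>c. T (0, c)) i + row_count h (\<lambda>c. T (1, c)) i = w i"
      using T_count[OF _ i, of 0] T_count[OF _ i, of 1] by simp
  qed
  moreover have "second_row_content n h T = \<nu>"
  proof
    fix i
    show "second_row_content n h T i = \<nu> i"
    proof (cases "i \<in> {1..n}")
      case True
      then show ?thesis by (simp add: second_row_content_def T_count nu_mu del: One_nat_def)
    next
      case False
      \<comment> \<open>Outside \<open>{1..n}\<close> both functions are \<open>undefined\<close>,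
        which is why \<open>second_row_content\<close> is a restriction.\<close>
      have "\<nu> \<in> (\<Pi>\<^sub>E i\<in>{1..n}. {0..int (w i)})"
        using nu unfolding ballot_tuples_def by blast
      then have "\<nu> i = undefined" using False by (rule PiE_arb)
      then show ?thesis unfolding second_row_content_def restrict_apply if_not_P[OF False] by simp
    qed
  qed
  ultimately show "\<nu> \<in> second_row_content n h ` {T. ssyt [h, h] T \<and> has_content [h, h] n w T}"
    by blast
qed

lemma kostka_two_row:
  assumes "(\<Sum>i = 1..n. w i) = 2 * h"
  shows "kostka [h, h] n w = card (ballot_tuples n w (int h))"
proof -
  have "second_row_content n h ` {T. ssyt [h, h] T \<and> has_content [h, h] n w T}
      = ballot_tuples n w (int h)"
    using ballot_tuples_subset_second_row_content[OF assms] second_row_content_in_ballot_tuples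
    by blast
  then show ?thesis
    unfolding kostka_def using card_image[OF inj_on_second_row_content] by metis
qed

section \<open>The Kostka number as a difference of tuple counts and as an alternating sum\<close>

theorem proposition3p2:
  fixes n :: nat and w :: "nat \<Rightarrow> nat"
  assumes "n \<ge> 1"
    and "\<exists>i\<in>{1..n}. w i \<noteq> 0"
    and "even (\<Sum>i\<in>{1..n}. w i)"
  shows "let h = (\<Sum>i\<in>{1..n}. w i) div 2 in
     int (kostka [h, h] n w)
       = int (tuple_count n w (int h)) - int (tuple_count n w (int h - 1))
   \<and> int (tuple_count n w (int h)) - int (tuple_count n w (int h - 1))
       = (\<Sum>J | J \<subseteq> {1..n} \<and> (\<Sum>j\<in>J. w j) < h.
            (- 1) ^ card J
            * binom (int h - int (\<Sum>j\<in>J. w j) + int n - int (card J) - 2) (int n - 2))"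
proof -
  define h where "h = (\<Sum>i\<in>{1..n}. w i) div 2"
  have W: "(\<Sum>i = 1..n. w i) = 2 * h" using assms(3) by (simp add: h_def)
  have "(\<Sum>i = 1..n. w i) \<noteq> 0" using assms(2) by simp
  then have h: "0 < h" using W by linarith
  obtain m where n: "n = Suc m" using assms(1) by (cases n) auto
  let ?g = "\<lambda>J. geom_coeff m (int h - int (\<Sum>j\<in>J. w j) - int (card J))"
  have "int (kostka [h, h] n w) = int (tuple_count n w (int h)) - int (tuple_count n w (int h - 1))"
    unfolding kostka_two_row[OF W] by (intro card_ballot_tuples) (simp only: W)
  \<comment> \<open>The difference in \<open>k\<close> lowers the exponent from \<open>n\<close> to
    \<open>m = n - 1\<close>, whence the lower index n - 2.\<close>
  moreover have "int (tuple_count n w (int h)) - int (tuple_count n w (int h - 1))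
      = (\<Sum>J\<in>Pow {1..n}. (- 1) ^ card J * ?g J)"
    unfolding tuple_count_eq_incl_excl n incl_excl_diff unfolding incl_excl_def ..
  moreover have "\<dots> = (\<Sum>J | J \<subseteq> {1..n} \<and> (\<Sum>j\<in>J. w j) < h. (- 1) ^ card J * ?g J)"
  proof (rule sum.mono_neutral_right)
    show "\<forall>J\<in>Pow {1..n} - {J. J \<subseteq> {1..n} \<and> (\<Sum>j\<in>J. w j) < h}. (- 1) ^ card J * ?g J = 0"
    proof
      fix J assume J: "J \<in> Pow {1..n} - {J. J \<subseteq> {1..n} \<and> (\<Sum>j\<in>J. w j) < h}"
      \<comment> \<open>A dropped \<open>J\<close> has |w_J| \<ge> h > 0, so it is nonempty and
        subtracting \<open>card J\<close> makes the argument negative.\<close>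
      then have "finite J" "h \<le> (\<Sum>j\<in>J. w j)" "J \<noteq> {}"
        using h by (auto intro: finite_subset)
      then have "int h - int (\<Sum>j\<in>J. w j) - int (card J) < 0"
        by (metis card_gt_0_iff diff_less_eq add_0 le_diff_eq diff_le_0_iff_le of_nat_0_less_iff
            of_nat_le_iff le_less_trans)
      then show "(- 1) ^ card J * ?g J = 0" by (simp add: geom_coeff_neg)
    qed
  qed auto
  moreover have "\<dots> = (\<Sum>J | J \<subseteq> {1..n} \<and> (\<Sum>j\<in>J. w j) < h. (- 1) ^ card J
      * binom (int h - int (\<Sum>j\<in>J. w j) + int n - int (card J) - 2) (int n - 2))"
  proof (rule sum.cong[OF refl])
    fix J assume J: "J \<in> {J. J \<subseteq> {1..n} \<and> (\<Sum>j\<in>J. w j) < h}"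
    have "?g J = binom (int h - int (\<Sum>j\<in>J. w j) + int n - int (card J) - 2) (int n - 2)"
    proof (cases "m = 0")
      case True
      \<comment> \<open>For \<open>n = 1\<close> the lower index -1 makes \<open>binom\<close>
        vanish. Only \<open>J = {}\<close> remains, and its coefficient is 0 because h > 0.\<close>
      then have "J = {} \<or> J = {1}" "w 1 = 2 * h" using J W by (auto simp: n)
      then have "J = {}" using J by auto
      then show ?thesis using True h by (simp add: n geom_coeff_def binom_def)
    next
      case False
      then show ?thesis by (simp add: n geom_coeff_def algebra_simps)
    qed
    then show "(- 1) ^ card J * ?g J = (- 1) ^ card J
      * binom (int h - int (\<Sum>j\<in>J. w j) + int n - int (card J) - 2) (int n - 2)"
      by simp
  qed
  ultimately show ?thesis unfolding Let_def h_def[symmetric] by simp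
qed

end
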